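(* There exist a Tychonoff paratopological group $X$ and a Hausdorff compactification $bX$ of $X$ such that the remainder $bX\setminus X$ is neither pseudocompact nor meager.
   Context: All spaces are assumed to be Tychonoff. A paratopological group is a group with a topology such that the product map $(x,y)\mapsto xy$ is jointly continuous (inversion is not assumed continuous). A space is meager if it can be represented as the union of a sequence of its nowhere dense subsets. A Tychonoff space is pseudocompact if every continuous real-valued function on it is bounded. *)

theory Defs
  imports "HOL-Analysis.Analysis" "HOL-Algebra.Group"
begin

definition Tychonoff_space :: "'a topology \<Rightarrow> bool" where
  "Tychonoff_space T \<longleftrightarrow> completely_regular_space T \<and> Hausdorff_space T"

definition paratopological_group :: "('a, 'm) monoid_scheme \<Rightarrow> 'a topology \<Rightarrow> bool" where
  "paratopological_group G T \<longleftrightarrow>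
     group G \<and> topspace T = carrier G \<and>
     continuous_map (prod_topology T T) T (\<lambda>(x, y). x \<otimes>\<^bsub>G\<^esub> y)"

definition Hausdorff_compactification ::
    "'a topology \<Rightarrow> 'b topology \<Rightarrow> ('a \<Rightarrow> 'b) \<Rightarrow> bool" where
  "Hausdorff_compactification T K e \<longleftrightarrow>
     compact_space K \<and> Hausdorff_space K \<and>
     embedding_map T K e \<and> K closure_of (e ` topspace T) = topspace K"

definition remainder :: "'a topology \<Rightarrow> 'b topology \<Rightarrow> ('a \<Rightarrow> 'b) \<Rightarrow> 'b topology" where
  "remainder T K e = subtopology K (topspace K - e ` topspace T)"

(* Stated for arbitrary spaces; it is only applied to Tychonoff ones: a remainder is a
   subspace of a compact Hausdorff space. *)
definition pseudocompact_space :: "'a topology \<Rightarrow> bool" where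
  "pseudocompact_space T \<longleftrightarrow>
     (\<forall>f :: 'a \<Rightarrow> real. continuous_map T euclideanreal f \<longrightarrow> bounded (f ` topspace T))"

definition nowhere_dense_in :: "'a topology \<Rightarrow> 'a set \<Rightarrow> bool" where
  "nowhere_dense_in T A \<longleftrightarrow> A \<subseteq> topspace T \<and> T interior_of (T closure_of A) = {}"

definition meager_space :: "'a topology \<Rightarrow> bool" where
  "meager_space T \<longleftrightarrow>
     (\<exists>A :: nat \<Rightarrow> 'a set. (\<forall>n. nowhere_dense_in T (A n)) \<and> topspace T = (\<Union>n. A n))"

end

(* X is the Sorgenfrey line and bX the space of all down-sets of the reals (the double arrow
   space with two end points), the real x being identified with the closed ray {..x}. The
   remainder consists of the open rays {..<x} and the two trivial down-sets: it is a reversed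
   Sorgenfrey line, so it carries an unbounded locally constant function, and the Baire property of
   the Euclidean line transfers to it because both topologies have the same nowhere dense sets. *)
theory Submission
  imports Defs
begin

section \<open>The compact Hausdorff space of down-sets of the reals\<close>

definition real_cuts :: "real set set" where
  "real_cuts = {A. \<forall>x\<in>A. {..x} \<subseteq> A}"

definition cut_subbasic :: "real set set \<Rightarrow> bool" where
  "cut_subbasic W \<longleftrightarrow> (\<exists>x. W = {A. x \<in> A} \<or> W = {A. x \<notin> A})"

text \<open>This is the topology of pointwise convergence of indicator functions, so the space sits
  inside the Cantor cube over the reals. Giving it by a subbase makes Alexander's lemma directly
  applicable.\<close>

definition cut_topology :: "real set topology" where
  "cut_topology = topology (arbitrary union_of
     (finite intersection_of cut_subbasic relative_to real_cuts))"

text \<open>The subbasic sets pull back to the rays \<open>{x..}\<close> and \<open>{..<x}\<close>,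
  which generate the half-open intervals \<open>{a..<b}\<close>.\<close>

definition Sorgenfrey :: "real topology" where
  "Sorgenfrey = pullback_topology UNIV atMost cut_topology"

lemma topspace_cut_topology [simp]: "topspace cut_topology = real_cuts"
  by (simp add: cut_topology_def)

lemma atMost_in_real_cuts [simp]: "{..x} \<in> real_cuts"
  and lessThan_in_real_cuts [simp]: "{..<x} \<in> real_cuts"
  by (auto simp: real_cuts_def)

lemma real_cutsD: "A \<in> real_cuts \<Longrightarrow> x \<in> A \<Longrightarrow> y \<le> x \<Longrightarrow> y \<in> A"
  by (auto simp: real_cuts_def)

lemma openin_cut_subbasic:
  assumes "cut_subbasic W"
  shows "openin cut_topology (real_cuts \<inter> W)"
proof -
  have "(finite intersection_of cut_subbasic) W"
    using assms by (rule finite_intersection_of_inc)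
  then have "(finite intersection_of cut_subbasic relative_to real_cuts) (real_cuts \<inter> W)"
    by (rule relative_to_inc)
  then show ?thesis
    unfolding cut_topology_def openin_subbase by (rule arbitrary_union_of_inc)
qed

lemma openin_cut_mem [simp]: "openin cut_topology {A \<in> real_cuts. x \<in> A}"
  and openin_cut_not_mem [simp]: "openin cut_topology {A \<in> real_cuts. x \<notin> A}"
  using openin_cut_subbasic[of "{A. x \<in> A}"] openin_cut_subbasic[of "{A. x \<notin> A}"]
  by (auto simp: cut_subbasic_def Int_def)

text \<open>Each subbasic set tests membership of a single real, so finitely many of them are
  decided by a finite set \<open>F\<close> of points to be contained and a finite set
  \<open>G\<close> of points to be avoided.\<close>

lemma finite_Inter_cut_subbasic:
  assumes "finite \<U>" "\<U> \<subseteq> Collect cut_subbasic" "A \<in> \<Inter>\<U>"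
  shows "\<exists>F G. finite F \<and> finite G \<and> F \<subseteq> A \<and> G \<inter> A = {} \<and>
    (\<forall>B. F \<subseteq> B \<and> G \<inter> B = {} \<longrightarrow> B \<in> \<Inter>\<U>)"
  using assms
proof (induction \<U>)
  case empty
  show ?case by (intro exI[of _ "{}"]) auto
next
  case (insert W \<U>)
  then have "\<U> \<subseteq> Collect cut_subbasic" "A \<in> \<Inter>\<U>" by simp_all
  from insert.IH[OF this] obtain F G where FG: "finite F" "finite G" "F \<subseteq> A" "G \<inter> A = {}"
    "\<forall>B. F \<subseteq> B \<and> G \<inter> B = {} \<longrightarrow> B \<in> \<Inter>\<U>"
    by (elim exE conjE)
  from insert.prems obtain x where "W = {A. x \<in> A} \<or> W = {A. x \<notin> A}"
    by (auto simp: cut_subbasic_def)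
  then show ?case
  proof
    assume W: "W = {A. x \<in> A}"
    show ?thesis
      by (rule exI[of _ "insert x F"], rule exI[of _ G]) (use FG W insert.prems in auto)
  next
    assume W: "W = {A. x \<notin> A}"
    show ?thesis
      by (rule exI[of _ F], rule exI[of _ "insert x G"]) (use FG W insert.prems in auto)
  qed
qed

lemma cut_topology_nhd:
  assumes "openin cut_topology W" "A \<in> W"
  obtains F G where "finite F" "finite G" "F \<subseteq> A" "G \<inter> A = {}"
    "\<And>B. B \<in> real_cuts \<Longrightarrow> F \<subseteq> B \<Longrightarrow> G \<inter> B = {} \<Longrightarrow> B \<in> W"
proof -
  obtain V where V: "(finite intersection_of cut_subbasic relative_to real_cuts) V" "A \<in> V" "V \<subseteq> W"
    using assms unfolding cut_topology_def openin_subbase by (auto simp: union_of_def)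
  then obtain \<U> where \<U>: "finite \<U>" "\<U> \<subseteq> Collect cut_subbasic" "V = real_cuts \<inter> \<Inter>\<U>"
    by (auto simp: relative_to_def intersection_of_def)
  with V(2) have "A \<in> \<Inter>\<U>" by blast
  from finite_Inter_cut_subbasic[OF \<U>(1,2) this]
  obtain F G where FG: "finite F" "finite G" "F \<subseteq> A" "G \<inter> A = {}"
    "\<forall>B. F \<subseteq> B \<and> G \<inter> B = {} \<longrightarrow> B \<in> \<Inter>\<U>"
    by (elim exE conjE)
  show thesis
    using that[OF FG(1-4)] FG(5) V(3) \<U>(3) by blast
qed

text \<open>An open ray has one-sided basic neighbourhoods among the open rays. Moving its end point
  to the left never violates the avoidance of \<open>G\<close>, so only the finite set
  \<open>F\<close> limits how far it may move.\<close>

lemma cut_topology_nhd_lessThan: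
  assumes "openin cut_topology W" "{..<x} \<in> W" "a < x"
  obtains c where "a \<le> c" "c < x" "\<And>y. c < y \<Longrightarrow> y \<le> x \<Longrightarrow> {..<y} \<in> W"
proof -
  obtain F G where FG: "finite F" "finite G" "F \<subseteq> {..<x}" "G \<inter> {..<x} = {}"
    "\<And>B. B \<in> real_cuts \<Longrightarrow> F \<subseteq> B \<Longrightarrow> G \<inter> B = {} \<Longrightarrow> B \<in> W"
    using cut_topology_nhd[OF assms(1,2)] by blast
  \<comment> \<open>Inserting \<open>a\<close> keeps the maximum meaningful when \<open>F\<close> is
    empty and yields the bound \<open>a \<le> c\<close>.\<close>
  let ?c = "Max (insert a F)"
  have c: "\<And>f. f \<in> F \<Longrightarrow> f \<le> ?c" "a \<le> ?c"
    using FG(1) by auto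
  show thesis
  proof (rule that[OF c(2)])
    show "?c < x" using FG(1,3) assms(3) by auto
    show "{..<y} \<in> W" if "?c < y" "y \<le> x" for y
    proof (rule FG(5))
      show "F \<subseteq> {..<y}" using c(1) that(1) by fastforce
      show "G \<inter> {..<y} = {}" using FG(4) that(2) by fastforce
    qed simp
  qed
qed

lemma compact_cut_topology: "compact_space cut_topology"
proof (rule Alexander_subbase_alt)
  show "topology (arbitrary union_of
      (finite intersection_of (\<lambda>W. W \<in> Collect cut_subbasic) relative_to real_cuts)) = cut_topology"
    by (simp add: cut_topology_def)
  show "real_cuts \<subseteq> \<Union>(Collect cut_subbasic)"
    using cut_subbasic_def by blast
next
  fix C assume C: "C \<subseteq> Collect cut_subbasic" "real_cuts \<subseteq> \<Union>C"
  \<comment> \<open>The least down-set that no member of \<open>C\<close> of the form "y is avoided"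
    covers. It is a point of the space even if it is empty or everything, and so a member of the
    form "x is contained" must cover it.\<close>
  define A where "A = (\<Union>y\<in>{y. {A. y \<notin> A} \<in> C}. {..y})"
  have "A \<in> real_cuts"
    unfolding A_def real_cuts_def by force
  then obtain W where W: "W \<in> C" "A \<in> W"
    using C(2) by blast
  have "y \<in> A" if "{A. y \<notin> A} \<in> C" for y
    using that by (auto simp: A_def)
  moreover obtain x where "W = {A. x \<in> A} \<or> W = {A. x \<notin> A}"
    using W(1) C(1) unfolding cut_subbasic_def by blast
  ultimately have x: "{A. x \<in> A} \<in> C" "x \<in> A"
    using W by auto
  then obtain y where y: "{A. y \<notin> A} \<in> C" "x \<le> y"
    by (auto simp: A_def)
  \<comment> \<open>Two members suffice: a down-set that contains y also contains the smaller
    x.\<close>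
  have "real_cuts \<subseteq> \<Union>{{A. x \<in> A}, {A. y \<notin> A}}"
    using y(2) real_cutsD by auto
  then show "\<exists>C'. finite C' \<and> C' \<subseteq> C \<and> real_cuts \<subseteq> \<Union>C'"
    using x(1) y(1) by (intro exI[of _ "{{A. x \<in> A}, {A. y \<notin> A}}"]) auto
qed

lemma Hausdorff_cut_topology: "Hausdorff_space cut_topology"
  unfolding Hausdorff_space_def
proof (intro allI impI)
  fix A B assume "A \<in> topspace cut_topology \<and> B \<in> topspace cut_topology \<and> A \<noteq> B"
  then obtain x where AB: "A \<in> real_cuts" "B \<in> real_cuts" "(x \<in> A) \<noteq> (x \<in> B)"
    by auto
  let ?U = "{A \<in> real_cuts. x \<in> A}" and ?V = "{A \<in> real_cuts. x \<notin> A}"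
  have "disjnt ?U ?V" "disjnt ?V ?U" by (auto simp: disjnt_def)
  with AB show "\<exists>U V. openin cut_topology U \<and> openin cut_topology V \<and> A \<in> U \<and> B \<in> V \<and> disjnt U V"
    using openin_cut_mem[of x] openin_cut_not_mem[of x]
    by (cases "x \<in> A") (metis (mono_tags, lifting) mem_Collect_eq)+
qed

section \<open>The Sorgenfrey line as a Tychonoff paratopological group\<close>

lemma topspace_Sorgenfrey [simp]: "topspace Sorgenfrey = UNIV"
  by (auto simp: Sorgenfrey_def topspace_pullback_topology)

lemma openin_Sorgenfrey_atLeast [simp]: "openin Sorgenfrey {a..}"
  unfolding Sorgenfrey_def openin_pullback_topology
  by (intro exI[of _ "{A \<in> real_cuts. a \<in> A}"]) auto

lemma openin_Sorgenfrey_lessThan [simp]: "openin Sorgenfrey {..<a}"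
  unfolding Sorgenfrey_def openin_pullback_topology
  by (intro exI[of _ "{A \<in> real_cuts. a \<notin> A}"]) auto

text \<open>The open sets of the domain are exactly the preimages under \<open>atMost\<close>, which
  is injective, so continuity and openness onto the range both come from the pullback.\<close>

lemma embedding_map_atMost: "embedding_map Sorgenfrey cut_topology atMost"
proof -
  have "continuous_map Sorgenfrey cut_topology (id \<circ> atMost)"
    unfolding Sorgenfrey_def by (intro continuous_map_pullback continuous_map_id)
  then have "continuous_map Sorgenfrey (subtopology cut_topology (range atMost)) atMost"
    by (simp add: continuous_map_in_subtopology)
  moreover have "open_map Sorgenfrey (subtopology cut_topology (range atMost)) atMost"
    unfolding open_map_def
  proof (intro allI impI)
    fix U assume "openin Sorgenfrey U"
    then obtain V where "openin cut_topology V" "U = atMost -` V"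
      by (auto simp: Sorgenfrey_def openin_pullback_topology)
    then show "openin (subtopology cut_topology (range atMost)) (atMost ` U)"
      by (auto simp: openin_subtopology)
  qed
  ultimately show ?thesis
    unfolding embedding_map_def
    by (intro bijective_open_imp_homeomorphic_map) (auto simp: inj_on_def)
qed

text \<open>Both properties are inherited from the compact Hausdorff, hence normal, space of cuts
  through the embedding.\<close>

lemma Tychonoff_Sorgenfrey: "Tychonoff_space Sorgenfrey"
proof -
  have hom: "Sorgenfrey homeomorphic_space subtopology cut_topology (range atMost)"
    using embedding_map_imp_homeomorphic_space[OF embedding_map_atMost] by simp
  have "completely_regular_space cut_topology"
    by (simp add: normal_imp_completely_regular_space compact_Hausdorff_or_regular_imp_normal_space
        compact_cut_topology Hausdorff_cut_topology)
  then show ?thesis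
    using homeomorphic_completely_regular_space[OF hom] homeomorphic_Hausdorff_space[OF hom]
    by (simp add: Tychonoff_space_def completely_regular_space_subtopology
        Hausdorff_space_subtopology Hausdorff_cut_topology)
qed

lemma continuous_map_add_Sorgenfrey:
  "continuous_map (prod_topology Sorgenfrey Sorgenfrey) Sorgenfrey (\<lambda>(x, y). x + y)"
proof -
  let ?P = "prod_topology Sorgenfrey Sorgenfrey"
  have ge: "openin ?P {p. a \<le> fst p + snd p}" for a
    unfolding openin_prod_topology_alt
  proof (intro allI impI)
    fix x y assume "(x, y) \<in> {p. a \<le> fst p + snd p}"
    then show "\<exists>U V. openin Sorgenfrey U \<and> openin Sorgenfrey V \<and> x \<in> U \<and> y \<in> V \<and>
        U \<times> V \<subseteq> {p. a \<le> fst p + snd p}"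
      by (intro exI[of _ "{x..}"] exI[of _ "{y..}"]) auto
  qed
  have less: "openin ?P {p. fst p + snd p < a}" for a
    unfolding openin_prod_topology_alt
  proof (intro allI impI)
    fix x y assume "(x, y) \<in> {p. fst p + snd p < a}"
    \<comment> \<open>The slack \<open>a - x - y\<close> is shared equally between the two
      summands.\<close>
    then have "x < x + (a - x - y) / 2" "y < y + (a - x - y) / 2" by simp_all
    moreover have "{..<x + (a - x - y) / 2} \<times> {..<y + (a - x - y) / 2} \<subseteq> {p. fst p + snd p < a}"
      by (auto simp: field_simps)
    ultimately show "\<exists>U V. openin Sorgenfrey U \<and> openin Sorgenfrey V \<and> x \<in> U \<and> y \<in> V \<and>
        U \<times> V \<subseteq> {p. fst p + snd p < a}"
      by (intro exI[of _ "{..<x + (a - x - y) / 2}"] exI[of _ "{..<y + (a - x - y) / 2}"] conjI)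
        simp_all
  qed
  \<comment> \<open>Only subbasic sets have to be tested, and their preimages are the two kinds of
    half-plane shown open above.\<close>
  have "continuous_map ?P cut_topology (\<lambda>p. {..fst p + snd p})"
    unfolding cut_topology_def
  proof (rule continuous_map_into_topology_subbase)
    fix W assume "cut_subbasic W"
    then show "openin ?P {p \<in> topspace ?P. {..fst p + snd p} \<in> W}"
      using ge less by (auto simp: cut_subbasic_def not_le)
  qed simp
  then have "continuous_map ?P Sorgenfrey (\<lambda>p. fst p + snd p)"
    unfolding Sorgenfrey_def by (intro continuous_map_pullback') (auto simp: o_def)
  then show ?thesis by (simp add: case_prod_unfold)
qed

definition real_add_group :: "real monoid" where
  "real_add_group = \<lparr>carrier = UNIV, monoid.mult = (+), one = 0\<rparr>"

lemma paratopological_group_Sorgenfrey: "paratopological_group real_add_group Sorgenfrey"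
proof -
  have "group real_add_group"
    by (rule groupI) (auto simp: real_add_group_def intro: exI[of _ "- _"])
  then show ?thesis
    using continuous_map_add_Sorgenfrey
    by (simp add: paratopological_group_def real_add_group_def)
qed

section \<open>Density of the closed rays and the compactification\<close>

lemma dense_atMost: "cut_topology closure_of (range atMost) = real_cuts"
proof
  show "cut_topology closure_of (range atMost) \<subseteq> real_cuts"
    using closure_of_subset_topspace[of cut_topology] by simp
  show "real_cuts \<subseteq> cut_topology closure_of (range atMost)"
  proof (clarsimp simp: in_closure_of)
    fix A W assume A: "A \<in> real_cuts" "A \<in> W" "openin cut_topology W"
    obtain F G where FG: "finite F" "finite G" "F \<subseteq> A" "G \<inter> A = {}"
      "\<And>B. B \<in> real_cuts \<Longrightarrow> F \<subseteq> B \<Longrightarrow> G \<inter> B = {} \<Longrightarrow> B \<in> W"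
      using cut_topology_nhd[OF A(3,2)] by blast
    \<comment> \<open>Such an x makes \<open>{..x}\<close> contain \<open>F\<close> and avoid
      \<open>G\<close>. If \<open>F\<close> is nonempty, its maximum works, because the down-set
      \<open>A\<close> contains it and omits all of \<open>G\<close>. Otherwise any point below
      \<open>G\<close> works; the inserted 0 covers the case of empty \<open>G\<close>.\<close>
    have "\<exists>x. (\<forall>f\<in>F. f \<le> x) \<and> (\<forall>g\<in>G. x < g)"
    proof (cases "F = {}")
      case True
      have "Min (insert 0 G) - 1 < g" if "g \<in> G" for g
        using Min_le[of "insert 0 G" g] FG(2) that by (smt (verit) finite_insert insertI2)
      with True show ?thesis by blast
    next
      case False
      then have "Max F \<in> A" using FG(1,3) Max_in by blast
      then have "Max F < g" if "g \<in> G" for g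
        using that FG(4) real_cutsD[OF A(1), of "Max F" g] by force
      with FG(1) show ?thesis by (metis Max_ge)
    qed
    then obtain x where "\<forall>f\<in>F. f \<le> x" "\<forall>g\<in>G. x < g" by blast
    then have "{..x} \<in> W" by (intro FG(5)) fastforce+
    then show "\<exists>x. {..x} \<in> W" ..
  qed
qed

lemma Hausdorff_compactification_Sorgenfrey:
  "Hausdorff_compactification Sorgenfrey cut_topology atMost"
  by (simp add: Hausdorff_compactification_def compact_cut_topology Hausdorff_cut_topology
      embedding_map_atMost dense_atMost)

section \<open>The remainder: its points, an unbounded continuous function, and Baire
  category\<close>

abbreviation open_cuts :: "real set topology" where
  "open_cuts \<equiv> remainder Sorgenfrey cut_topology atMost"

lemma topspace_open_cuts: "topspace open_cuts = real_cuts - range atMost"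
  by (auto simp: remainder_def)

lemma lessThan_in_open_cuts [simp]: "{..<x} \<in> topspace open_cuts"
proof -
  have "{..<x} \<noteq> {..y}" for y
    using dense[of y x] by (metis atMost_iff lessThan_iff linorder_not_less order_refl)
  then show ?thesis by (auto simp: topspace_open_cuts)
qed

lemma openin_open_cuts:
  "openin open_cuts U \<longleftrightarrow> (\<exists>W. openin cut_topology W \<and> U = W \<inter> topspace open_cuts)"
  by (auto simp: topspace_open_cuts remainder_def openin_subtopology dest: openin_subset)

lemma openin_open_cuts_between: "openin open_cuts {A \<in> topspace open_cuts. a \<in> A \<and> b \<notin> A}"
  unfolding openin_open_cuts
  by (intro exI[of _ "{A \<in> real_cuts. a \<in> A} \<inter> {A \<in> real_cuts. b \<notin> A}"] conjI openin_Int)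
    (auto simp: topspace_open_cuts)

text \<open>The points a and b exclude the two trivial down-sets, so the supremum exists. It cannot
  belong to \<open>A\<close>, since \<open>A\<close> would then be a closed ray, which the remainder
  omits.\<close>

lemma open_cut_eq_lessThan:
  assumes "A \<in> topspace open_cuts" "a \<in> A" "b \<notin> A"
  shows "A = {..<Sup A}"
proof -
  have A: "A \<in> real_cuts" "A \<noteq> {..Sup A}"
    using assms(1) by (auto simp: topspace_open_cuts)
  have "z \<le> b" if "z \<in> A" for z
    using real_cutsD[OF A(1) that, of b] assms(3) linear by blast
  then have bdd: "bdd_above A" by (auto simp: bdd_above_def)
  have less: "z \<in> A" if "z < Sup A" for z
    using that less_cSup_iff[OF _ bdd, of z] assms(2) real_cutsD[OF A(1)] by force
  have le: "z \<le> Sup A" if "z \<in> A" for z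
    using that bdd by (rule cSup_upper)
  have "Sup A \<notin> A"
  proof
    assume "Sup A \<in> A"
    then have "A = {..Sup A}" using le real_cutsD[OF A(1)] by blast
    with A(2) show False by blast
  qed
  with less le show ?thesis by (force simp: order_less_le)
qed

text \<open>The point \<open>{..0}\<close> is missing from the remainder but is the limit of the
  rays \<open>{..<x}\<close> as x decreases to 0. A step function with ever higher steps towards
  this gap is locally constant and unbounded.\<close>

lemma not_pseudocompact_open_cuts: "\<not> pseudocompact_space open_cuts"
proof
  assume pc: "pseudocompact_space open_cuts"
  define r :: "nat \<Rightarrow> real" where "r n = inverse (real (Suc n))" for n
  have r_mono: "r m \<le> r n" if "n \<le> m" for m n
    using that by (simp add: r_def)
  have r_less: "r m < r n \<longleftrightarrow> n < m" for m n
    by (simp add: r_def)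
  define k :: "real set \<Rightarrow> nat" where "k A = (if 0 \<in> A then LEAST n. r n \<in> A else 0)" for A
  \<comment> \<open>This is where the absence of \<open>{..0}\<close> enters: a cut of the remainder
    that contains 0 must also contain a positive number.\<close>
  have ex: "\<exists>n. r n \<in> A" if A': "A \<in> topspace open_cuts" "0 \<in> A" for A
  proof -
    have A: "A \<in> real_cuts" "A \<noteq> {..0}"
      using A'(1) by (auto simp: topspace_open_cuts)
    then obtain x where "x \<in> A" "0 < x"
      using A'(2) real_cutsD[OF A(1)] by (metis atMost_iff linorder_not_less subsetI subset_antisym)
    moreover from \<open>0 < x\<close> obtain n where "r n < x"
      unfolding r_def using reals_Archimedean by blast
    ultimately show ?thesis
      using real_cutsD[OF A(1)] less_imp_le by blast
  qed
  have nbhd: "\<exists>U. openin open_cuts U \<and> A \<in> U \<and> (\<forall>B\<in>U. k B = k A)"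
    if A: "A \<in> topspace open_cuts" for A
  proof (cases "0 \<in> A")
    case False
    have "openin open_cuts {A \<in> topspace open_cuts. 0 \<notin> A}"
      unfolding openin_open_cuts
      by (intro exI[of _ "{A \<in> real_cuts. 0 \<notin> A}"]) (auto simp: topspace_open_cuts)
    with False A show ?thesis by (intro exI conjI) (assumption, auto simp: k_def)
  next
    case True
    have kA: "r (k A) \<in> A" "\<And>n. n < k A \<Longrightarrow> r n \<notin> A"
      using LeastI_ex[OF ex[OF A True]] not_less_Least True by (auto simp: k_def)
    let ?U = "{B \<in> real_cuts. r (k A) \<in> B}"
    \<comment> \<open>Containing \<open>r (k A)\<close> and omitting the preceding, larger threshold
      pins the value of \<open>k\<close>. When \<open>k A = 0\<close> there is no preceding
      threshold, and truncated subtraction would return \<open>r 0\<close> itself, making the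
      neighbourhood empty.\<close>
    let ?V = "if k A = 0 then real_cuts else {B \<in> real_cuts. r (k A - 1) \<notin> B}"
    have "openin cut_topology (?U \<inter> ?V)"
      using openin_topspace[of cut_topology] by (intro openin_Int) auto
    then have "openin open_cuts (?U \<inter> ?V \<inter> topspace open_cuts)"
      unfolding openin_open_cuts by blast
    moreover have "A \<in> ?U \<inter> ?V \<inter> topspace open_cuts"
      using kA A by (auto simp: topspace_open_cuts)
    moreover have "k B = k A" if B: "B \<in> ?U \<inter> ?V \<inter> topspace open_cuts" for B
    proof -
      have cut: "B \<in> real_cuts" and rB: "r (k A) \<in> B" using B by auto
      have "0 \<in> B" using real_cutsD[OF cut rB] by (simp add: r_def)
      moreover have "(LEAST n. r n \<in> B) = k A"
      proof (rule Least_equality[of "\<lambda>n. r n \<in> B", OF rB])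
        fix n assume n: "r n \<in> B"
        show "k A \<le> n"
        proof (rule ccontr)
          assume "\<not> k A \<le> n"
          then have "k A \<noteq> 0" "n \<le> k A - 1" by auto
          then show False
            using real_cutsD[OF cut n r_mono[of n "k A - 1"]] B by auto
        qed
      qed
      ultimately show ?thesis by (simp add: k_def)
    qed
    ultimately show ?thesis by blast
  qed
  have "continuous_map open_cuts euclideanreal (\<lambda>A. real (k A))"
    unfolding continuous_map_def
  proof (intro conjI allI impI)
    \<comment> \<open>\<open>S\<close> may be arbitrary: local constancy makes every preimage
      open.\<close>
    fix S :: "real set"
    show "openin open_cuts {A \<in> topspace open_cuts. real (k A) \<in> S}"
    proof (subst openin_subopen, intro ballI)
      fix A assume A: "A \<in> {A \<in> topspace open_cuts. real (k A) \<in> S}"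
      then obtain U where U: "openin open_cuts U" "A \<in> U" "\<forall>B\<in>U. k B = k A"
        using nbhd[of A] by blast
      have "U \<subseteq> {A \<in> topspace open_cuts. real (k A) \<in> S}"
        using A U(3) openin_subset[OF U(1)] by auto
      with U show "\<exists>T. openin open_cuts T \<and> A \<in> T \<and> T \<subseteq> {A \<in> topspace open_cuts. real (k A) \<in> S}"
        by blast
    qed
  qed simp
  then have "bounded ((\<lambda>A. real (k A)) ` topspace open_cuts)"
    using pc by (simp add: pseudocompact_space_def)
  then obtain M where M: "\<And>A. A \<in> topspace open_cuts \<Longrightarrow> real (k A) \<le> M"
    by (auto simp: bounded_iff)
  obtain n where "M < real n" using reals_Archimedean2 by blast
  \<comment> \<open>The ray omits its end point \<open>r n\<close>, so the first threshold inside it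
    is the next one.\<close>
  have "(LEAST m. r m \<in> {..<r n}) = Suc n"
    by (rule Least_equality) (auto simp: r_less)
  moreover have "0 < r n" by (simp add: r_def)
  ultimately have "k {..<r n} = Suc n" by (simp add: k_def)
  with M[OF lessThan_in_open_cuts[of "r n"]] \<open>M < real n\<close> show False by simp
qed

text \<open>Every neighbourhood of an open ray in the remainder contains the rays ending in some
  nonempty Euclidean open interval. Euclidean density on an interval therefore gives density on a
  nonempty open set of the remainder.\<close>

lemma nowhere_dense_open_cuts_imp_nowhere_dense:
  assumes "nowhere_dense_in open_cuts N"
  shows "interior (closure {x. {..<x} \<in> N}) = {}"
proof (rule ccontr)
  let ?B = "{x. {..<x} \<in> N}"
  assume "interior (closure ?B) \<noteq> {}"
  then obtain m where "m \<in> interior (closure ?B)" by blast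
  then obtain e where e: "e > 0" "ball m e \<subseteq> closure ?B"
    by (meson mem_interior)
  \<comment> \<open>These are the rays \<open>{..<x}\<close> with \<open>m < x \<le> m + e\<close>,
    corresponding to the right half of the ball. The end point \<open>m + e\<close> is outside the
    ball, but the open intervals used to its left lie inside.\<close>
  let ?U = "{A \<in> topspace open_cuts. m \<in> A \<and> m + e \<notin> A}"
  have "?U \<subseteq> (open_cuts closure_of N)"
  proof
    fix A assume A: "A \<in> ?U"
    then obtain x where x: "A = {..<x}"
      using open_cut_eq_lessThan by blast
    with A have mx: "m < x" "x \<le> m + e" by auto
    show "A \<in> open_cuts closure_of N"
      unfolding in_closure_of
    proof (intro conjI allI impI)
      show "A \<in> topspace open_cuts" using A by simp
      fix T assume T: "A \<in> T \<and> openin open_cuts T"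
      then obtain W where W: "openin cut_topology W" "T = W \<inter> topspace open_cuts"
        by (auto simp: openin_open_cuts)
      with T x have "{..<x} \<in> W" by auto
      then obtain c where c: "m \<le> c" "c < x" "\<And>y. c < y \<Longrightarrow> y \<le> x \<Longrightarrow> {..<y} \<in> W"
        using cut_topology_nhd_lessThan[OF W(1) _ mx(1)] by metis
      have "{c<..<x} \<subseteq> closure ?B"
        using e(2) c(1) mx(2) by (auto simp: ball_def dist_real_def)
      then have "{c<..<x} \<inter> closure ?B \<noteq> {}"
        using dense[OF c(2)] by fastforce
      then obtain y where "c < y" "y < x" "{..<y} \<in> N"
        using open_Int_closure_eq_empty[of "{c<..<x}" ?B] by fastforce
      then show "\<exists>y. y \<in> N \<and> y \<in> T"
        using c(3)[of y] W(2) by (intro exI[of _ "{..<y}"]) auto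
    qed
  qed
  then have "?U \<subseteq> (open_cuts interior_of (open_cuts closure_of N))"
    using openin_open_cuts_between by (rule interior_of_maximal)
  moreover have "{..<m + e} \<in> ?U"
    using e(1) by simp
  ultimately show False
    using assms unfolding nowhere_dense_in_def by blast
qed

text \<open>A cover of the remainder by countably many nowhere dense sets would, read off at the end
  points of open rays, cover the Euclidean line by nowhere dense sets, contradicting Baire's
  theorem.\<close>

lemma not_meager_open_cuts: "\<not> meager_space open_cuts"
proof
  assume "meager_space open_cuts"
  then obtain N :: "nat \<Rightarrow> real set set"
    where N: "\<And>n. nowhere_dense_in open_cuts (N n)" "topspace open_cuts = (\<Union>n. N n)"
    by (auto simp: meager_space_def)
  define B where "B n = {x. {..<x} \<in> N n}" for n
  have "UNIV \<subseteq> closure (\<Inter>n. - closure (B n))"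
  proof (rule Baire)
    fix T assume "T \<in> range (\<lambda>n. - closure (B n))"
    then obtain n where n: "T = - closure (B n)" by blast
    have "interior (closure (B n)) = {}"
      unfolding B_def using N(1) by (rule nowhere_dense_open_cuts_imp_nowhere_dense)
    then show "openin (top_of_set UNIV) T \<and> UNIV \<subseteq> closure T"
      by (simp add: n closure_complement open_Compl)
  qed auto
  \<comment> \<open>From the density given by Baire's theorem only one point x is taken; its ray
    \<open>{..<x}\<close> escapes every \<open>N n\<close>.\<close>
  then have "(\<Inter>n. - closure (B n)) \<noteq> {}" by (metis UNIV_not_empty closure_empty subset_empty)
  then obtain x where "\<And>n. x \<notin> closure (B n)" by blast
  moreover obtain n where "{..<x} \<in> N n"
    using N(2) lessThan_in_open_cuts by blast
  then have "x \<in> closure (B n)"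
    using closure_subset[of "B n"] by (auto simp: B_def)
  ultimately show False by blast
qed

theorem mainTheorem2:
  shows "\<exists>(G :: real monoid) (X :: real topology) (bX :: (real set) topology) (e :: real \<Rightarrow> real set).
     paratopological_group G X \<and> Tychonoff_space X \<and>
     Hausdorff_compactification X bX e \<and>
     \<not> pseudocompact_space (remainder X bX e) \<and>
     \<not> meager_space (remainder X bX e)"
  by (intro exI conjI)
    (rule paratopological_group_Sorgenfrey Tychonoff_Sorgenfrey Hausdorff_compactification_Sorgenfrey
      not_pseudocompact_open_cuts not_meager_open_cuts)+

end
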